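(* Let $R,S$ be arbitrary regexes in $\mathcal{R}$, let $\ell$ be an arbitrary lookaround (a regex of one of the forms $\mathtt{(?=}R\mathtt{)}$, $\mathtt{(?<=}R\mathtt{)}$, $\mathtt{(?!}R\mathtt{)}$, $\mathtt{(?<!}R\mathtt{)}$), and let $\psi\in\Psi$. For all valid locations $x$, $y$ and $s\langle i\rangle$ the following hold (in (6), $x$ and $y$ are moreover locations in the same string with $x\le y$; in (7), $z$ ranges over valid locations): (1) $x\xrightarrow{()}y \iff x=y$; (2) $x\xrightarrow{\ell}y \iff \mathit{Null}_x(\ell)$ and $x=y$; (3) $s\langle i\rangle\xrightarrow{\psi}y \iff s_i\in[\![\psi]\!]$ and $y=s\langle i+1\rangle$; (4) $x\xrightarrow{R\mathtt{|}S}y \iff (x\xrightarrow{R}y$ or $x\xrightarrow{S}y)$; (5) $x\xrightarrow{R\mathtt{\&}S}y \iff (x\xrightarrow{R}y$ and $x\xrightarrow{S}y)$; (6) $x\xrightarrow{\sim R}y \iff$ not $(x\xrightarrow{R}y)$; (7) $x\xrightarrow{R\cdot S}y \iff \exists z\,(x\xrightarrow{R}z$ and $z\xrightarrow{S}y)$; (8) for all admissible loop bounds $m,n$ with $m>0$: $R\{m,n\}\equiv R\cdot R\{m-1,n-1\}\equiv R\{m-1,n-1\}\cdot R$ (with $\infty-1=\infty$); (9) for all $n\ge 1$ or $n=\infty$: $R\{0,n\}\equiv R\{1,n\}\,\mathtt{|}\,()$.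
   Context: **Alphabet.** $\Sigma$ is a domain of characters, and $(\Sigma,\Psi,[\![\cdot]\!],\bot,\top,\vee,\wedge,\neg)$ is an effective Boolean algebra over $\Sigma$: $\Psi$ is a set of predicates closed under the connectives, $[\![\cdot]\!]:\Psi\to 2^\Sigma$, $[\![\bot]\!]=\emptyset$, $[\![\top]\!]=\Sigma$, $[\![\varphi\vee\psi]\!]=[\![\varphi]\!]\cup[\![\psi]\!]$, $[\![\varphi\wedge\psi]\!]=[\![\varphi]\!]\cap[\![\psi]\!]$, $[\![\neg\varphi]\!]=\Sigma\setminus[\![\varphi]\!]$. **Strings and locations.** For $s\in\Sigma^*$, $|s|$ is its length, $s_i$ ($0\le i<|s|$) its $i$-th character (indexing from 0), and $s_{-1}=s_{|s|}=\epsilon$ (the empty string, which belongs to no $[\![\psi]\!]$). $s^r$ is the reverse of $s$. A location in $s$ is a pair $s\langle i\rangle=\langle s,i\rangle$ with $-1\le i\le|s|$; it is valid if $0\le i\le|s|$ and final if $i=|s|$. Locations are ordered by position: $s\langle i\rangle<s\langle j\rangle$ iff $i<j$; $s\langle i\rangle+1=s\langle i+1\rangle$. The reverse of a valid location is $s\langle i\rangle^r=s^r\langle|s|-i\rangle$. The match failure is $\mathsf{fail}=\epsilon\langle-1\rangle$, and $\max(x,\mathsf{fail})=\max(\mathsf{fail},x)=x$. **Regexes.** $\mathcal{R}$ is generated by $$R::=\psi\mid()\mid R\,\mathtt{|}\,R'\mid R\,\mathtt{\&}\,R'\mid R\cdot R'\mid R\{m,n\}\mid\ \sim R\mid\mathtt{(?=}R\mathtt{)}\mid\mathtt{(?<=}R\mathtt{)}\mid\mathtt{(?!}R\mathtt{)}\mid\mathtt{(?<!}R\mathtt{)}$$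 with $\psi\in\Psi$ and loop bounds $m,n$ satisfying $0\le m\le n\ne0$ with $n$ finite, or $m\geq 0$ finite and $n=\infty$. Convention: $R\{0,0\}=()$. The last four forms (lookahead, lookback, negative lookahead, negative lookback) are called lookarounds. **Reverse of regexes.** $\psi^r=\psi$, $()^r=()$, $(R|S)^r=R^r|S^r$, $(R\&S)^r=R^r\&S^r$, $(R\cdot S)^r=S^r\cdot R^r$, $(R\{m,n\})^r=R^r\{m,n\}$, $(\sim R)^r=\sim(R^r)$, $\mathtt{(?=}R\mathtt{)}^r=\mathtt{(?<=}R^r\mathtt{)}$, $\mathtt{(?<=}R\mathtt{)}^r=\mathtt{(?=}R^r\mathtt{)}$, $\mathtt{(?!}R\mathtt{)}^r=\mathtt{(?<!}R^r\mathtt{)}$, $\mathtt{(?<!}R\mathtt{)}^r=\mathtt{(?!}R^r\mathtt{)}$. **Nullability, derivatives, match end** (mutually recursive). For valid $x$: $\mathit{Null}_x(())$ is true; $\mathit{Null}_x(\psi)$ is false; $\mathit{Null}_x(R|R')$ iff $\mathit{Null}_x(R)$ or $\mathit{Null}_x(R')$; $\mathit{Null}_x(R\&R')$ iff $\mathit{Null}_x(R\cdot R')$ iff $\mathit{Null}_x(R)$ and $\mathit{Null}_x(R')$; $\mathit{Null}_x(R\{m,n\})$ iff $m=0$ or $\mathit{Null}_x(R)$; $\mathit{Null}_x(\sim R)$ iff not $\mathit{Null}_x(R)$; $\mathit{Null}_x(\mathtt{(?=}R\mathtt{)})$ iff $\mathit{IsMatch}(x,R)$; $\mathit{Null}_x(\mathtt{(?<=}R\mathtt{)})$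 iff $\mathit{IsMatch}(x^r,R^r)$; $\mathit{Null}_x(\mathtt{(?!}R\mathtt{)})$ iff not $\mathit{IsMatch}(x,R)$; $\mathit{Null}_x(\mathtt{(?<!}R\mathtt{)})$ iff not $\mathit{IsMatch}(x^r,R^r)$. $\mathit{Null}_\forall(R)$ means that $\mathit{Null}_x(R)$ is true for all valid $x$ (in all strings). For valid nonfinal $x=s\langle i\rangle$ the derivative $\partial_x(R)\in\mathcal{R}$ is: $\partial_x(())=\bot$; $\partial_x(\ell)=\bot$ for lookarounds $\ell$; $\partial_{s\langle i\rangle}(\psi)=()$ if $s_i\in[\![\psi]\!]$, else $\bot$; $\partial_x(R|S)=\partial_x(R)|\partial_x(S)$; $\partial_x(R\&S)=\partial_x(R)\&\partial_x(S)$; $\partial_x(\sim R)=\sim\partial_x(R)$; $\partial_x(R\cdot S)=(\partial_x(R)\cdot S)\,|\,\partial_x(S)$ if $\mathit{Null}_x(R)$, else $\partial_x(R)\cdot S$; $\partial_x(R\{m,n\})=\partial_x(R)\cdot R\{m\dot-1,n\dot-1\}$ if $m=0$ or $\mathit{Null}_\forall(R)$ or not $\mathit{Null}_x(R)$, else $\partial_x(R\cdot R\{m\dot-1,n\dot-1\})$. Here $\infty\dot-1=\infty$, $0\dot-1=0$, $k\dot-1=k-1$ for $k>0$. $\mathit{Null}^{\mathsf{fail}}_x(R)=x$ if $\mathit{Null}_x(R)$, else $\mathsf{fail}$. $\mathit{MatchEnd}(x,R)=\mathit{Null}^{\mathsf{fail}}_x(R)$ if $x$ is final, else $\max(\mathit{Null}^{\mathsf{fail}}_x(R),\mathit{MatchEnd}(x+1,\partial_x(R)))$.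 $\mathit{IsMatch}(x,R)$ iff $\mathit{MatchEnd}(x,R)\ne\mathsf{fail}$. **Derivation relation.** For valid $x$, the set of all match ends is $(x\xrightarrow{R})=N_x(R)$ if $x$ is final, else $N_x(R)\cup(x+1\xrightarrow{\partial_x(R)})$, where $N_x(R)=\{x\}$ if $\mathit{Null}_x(R)$ and $\emptyset$ otherwise. Write $x\xrightarrow{R}y$ iff $y\in(x\xrightarrow{R})$. Regexes are equivalent, $R\equiv S$, if for all valid locations $x,y$: $x\xrightarrow{R}y\iff x\xrightarrow{S}y$. *)

theory Defs
  imports Main "HOL-Library.Extended_Nat"
begin

section \<open>Effective Boolean algebras\<close>

text \<open>
  The set of characters is the type \<^typ>\<open>'c\<close> and the set of predicates is the type \<^typ>\<open>'p\<close>,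
  so that closure of the predicates under the connectives holds by typing.
\<close>

record ('p, 'c) eba =
  sat :: "'p \<Rightarrow> 'c set"
  pfalse :: 'p
  ptrue :: 'p
  por :: "'p \<Rightarrow> 'p \<Rightarrow> 'p"
  pand :: "'p \<Rightarrow> 'p \<Rightarrow> 'p"
  pnot :: "'p \<Rightarrow> 'p"

locale effective_boolean_algebra =
  fixes A :: "('p, 'c) eba"
  assumes sat_pfalse: "sat A (pfalse A) = {}"
    and sat_ptrue: "sat A (ptrue A) = UNIV"
    and sat_por: "sat A (por A p q) = sat A p \<union> sat A q"
    and sat_pand: "sat A (pand A p q) = sat A p \<inter> sat A q"
    and sat_pnot: "sat A (pnot A p) = UNIV - sat A p"


section \<open>Locations\<close>

type_synonym 'c location = "'c list \<times> int"

text \<open>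
  \<open>char_in s i C\<close> says that the \<open>i\<close>-th character of \<open>s\<close> belongs to \<open>C\<close>. It is false at the
  positions \<open>-1\<close> and \<open>length s\<close>, where the character is the empty string.
\<close>

definition char_in :: "'c list \<Rightarrow> int \<Rightarrow> 'c set \<Rightarrow> bool" where
  "char_in s i C \<longleftrightarrow> 0 \<le> i \<and> i < int (length s) \<and> s ! nat i \<in> C"

definition valid :: "'c location \<Rightarrow> bool" where
  "valid x \<longleftrightarrow> 0 \<le> snd x \<and> snd x \<le> int (length (fst x))"

definition final :: "'c location \<Rightarrow> bool" where
  "final x \<longleftrightarrow> snd x = int (length (fst x))"

definition next_loc :: "'c location \<Rightarrow> 'c location" where
  "next_loc x = (fst x, snd x + 1)"

definition rev_loc :: "'c location \<Rightarrow> 'c location" where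
  "rev_loc x = (rev (fst x), int (length (fst x)) - snd x)"

definition fail :: "'c location" where
  "fail = ([], -1)"

definition max_loc :: "'c location \<Rightarrow> 'c location \<Rightarrow> 'c location" where
  "max_loc x y =
    (if x = fail then y else if y = fail then x else if snd x < snd y then y else x)"


section \<open>Regexes\<close>

datatype 'p regex =
    Pred 'p
  | Epsilon
  | Alt "'p regex" "'p regex"
  | And "'p regex" "'p regex"
  | Concat "'p regex" "'p regex"
  | Loop "'p regex" nat enat
  | Compl "'p regex"
  | Lookahead "'p regex"
  | Lookback "'p regex"
  | NegLookahead "'p regex"
  | NegLookback "'p regex"

definition loop_bounds :: "nat \<Rightarrow> enat \<Rightarrow> bool" where
  "loop_bounds m n \<longleftrightarrow> enat m \<le> n \<and> n \<noteq> 0"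

text \<open>The regexes proper are the terms all of whose loop bounds are admissible.\<close>

primrec wf_regex :: "'p regex \<Rightarrow> bool" where
  "wf_regex (Pred p) \<longleftrightarrow> True"
| "wf_regex Epsilon \<longleftrightarrow> True"
| "wf_regex (Alt R S) \<longleftrightarrow> wf_regex R \<and> wf_regex S"
| "wf_regex (And R S) \<longleftrightarrow> wf_regex R \<and> wf_regex S"
| "wf_regex (Concat R S) \<longleftrightarrow> wf_regex R \<and> wf_regex S"
| "wf_regex (Loop R m n) \<longleftrightarrow> loop_bounds m n \<and> wf_regex R"
| "wf_regex (Compl R) \<longleftrightarrow> wf_regex R"
| "wf_regex (Lookahead R) \<longleftrightarrow> wf_regex R"
| "wf_regex (Lookback R) \<longleftrightarrow> wf_regex R"
| "wf_regex (NegLookahead R) \<longleftrightarrow> wf_regex R"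
| "wf_regex (NegLookback R) \<longleftrightarrow> wf_regex R"

text \<open>
  \<open>loop R m n\<close> is the regex \<open>R{m,n}\<close> with the convention \<open>R{0,0} = ()\<close>. Truncated subtraction on
  \<^typ>\<open>nat\<close> and \<^typ>\<open>enat\<close> (where \<open>\<infinity> - 1 = \<infinity>\<close>) is the one used for loop bounds.
\<close>

definition loop :: "'p regex \<Rightarrow> nat \<Rightarrow> enat \<Rightarrow> 'p regex" where
  "loop R m n = (if m = 0 \<and> n = 0 then Epsilon else Loop R m n)"

fun is_lookaround :: "'p regex \<Rightarrow> bool" where
  "is_lookaround (Lookahead R) \<longleftrightarrow> True"
| "is_lookaround (Lookback R) \<longleftrightarrow> True"
| "is_lookaround (NegLookahead R) \<longleftrightarrow> True"
| "is_lookaround (NegLookback R) \<longleftrightarrow> True"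
| "is_lookaround _ \<longleftrightarrow> False"

primrec rev_regex :: "'p regex \<Rightarrow> 'p regex" where
  "rev_regex (Pred p) = Pred p"
| "rev_regex Epsilon = Epsilon"
| "rev_regex (Alt R S) = Alt (rev_regex R) (rev_regex S)"
| "rev_regex (And R S) = And (rev_regex R) (rev_regex S)"
| "rev_regex (Concat R S) = Concat (rev_regex S) (rev_regex R)"
| "rev_regex (Loop R m n) = Loop (rev_regex R) m n"
| "rev_regex (Compl R) = Compl (rev_regex R)"
| "rev_regex (Lookahead R) = Lookback (rev_regex R)"
| "rev_regex (Lookback R) = Lookahead (rev_regex R)"
| "rev_regex (NegLookahead R) = NegLookback (rev_regex R)"
| "rev_regex (NegLookback R) = NegLookahead (rev_regex R)"


section \<open>Nullability, derivatives and match ends\<close>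

text \<open>
  The next two measures serve only the termination proof: the nesting depth of lookarounds, which
  derivatives do not increase, and a size for which unfolding a loop once is a decrease.
\<close>

primrec look_depth :: "'p regex \<Rightarrow> nat" where
  "look_depth (Pred p) = 0"
| "look_depth Epsilon = 0"
| "look_depth (Alt R S) = max (look_depth R) (look_depth S)"
| "look_depth (And R S) = max (look_depth R) (look_depth S)"
| "look_depth (Concat R S) = max (look_depth R) (look_depth S)"
| "look_depth (Loop R m n) = look_depth R"
| "look_depth (Compl R) = look_depth R"
| "look_depth (Lookahead R) = Suc (look_depth R)"
| "look_depth (Lookback R) = Suc (look_depth R)"
| "look_depth (NegLookahead R) = Suc (look_depth R)"
| "look_depth (NegLookback R) = Suc (look_depth R)"

primrec unfold_size :: "'p regex \<Rightarrow> nat" where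
  "unfold_size (Pred p) = 1"
| "unfold_size Epsilon = 1"
| "unfold_size (Alt R S) = Suc (unfold_size R + unfold_size S)"
| "unfold_size (And R S) = Suc (unfold_size R + unfold_size S)"
| "unfold_size (Concat R S) = Suc (unfold_size R + unfold_size S)"
| "unfold_size (Loop R m n) = Suc m * (2 + unfold_size R)"
| "unfold_size (Compl R) = Suc (unfold_size R)"
| "unfold_size (Lookahead R) = Suc (unfold_size R)"
| "unfold_size (Lookback R) = Suc (unfold_size R)"
| "unfold_size (NegLookahead R) = Suc (unfold_size R)"
| "unfold_size (NegLookback R) = Suc (unfold_size R)"

lemma look_depth_rev [simp]: "look_depth (rev_regex R) = look_depth R"
  by (induction R) (auto simp: max.commute)

lemma look_depth_loop_le: "look_depth (loop R m n) \<le> look_depth R"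
  by (simp add: loop_def)

lemma unfold_size_loop_less:
  "0 < m \<Longrightarrow> unfold_size (Concat R (loop R (m - 1) (n - 1))) < unfold_size (Loop R m n)"
  by (cases m) (auto simp: loop_def)

text \<open>
  Values at invalid locations are immaterial. At such locations \<open>match_end\<close> below stops
  instead of advancing, because a position to the right of the string never becomes final. The
  condition \<open>\<forall>y. valid y \<longrightarrow> null y R\<close> in the derivative of a loop ranges over locations in all strings.
\<close>

context
  fixes A :: "('p, 'c) eba"
begin

function null :: "'c location \<Rightarrow> 'p regex \<Rightarrow> bool"
  and der :: "'c location \<Rightarrow> 'p regex \<Rightarrow> 'p regex"
  and match_end :: "'c location \<Rightarrow> 'p regex \<Rightarrow> 'c location"
  and is_match :: "'c location \<Rightarrow> 'p regex \<Rightarrow> bool"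
where
  "null x (Pred p) \<longleftrightarrow> False"
| "null x Epsilon \<longleftrightarrow> True"
| "null x (Alt R S) \<longleftrightarrow> null x R \<or> null x S"
| "null x (And R S) \<longleftrightarrow> null x R \<and> null x S"
| "null x (Concat R S) \<longleftrightarrow> null x R \<and> null x S"
| "null x (Loop R m n) \<longleftrightarrow> m = 0 \<or> null x R"
| "null x (Compl R) \<longleftrightarrow> \<not> null x R"
| "null x (Lookahead R) \<longleftrightarrow> is_match x R"
| "null x (Lookback R) \<longleftrightarrow> is_match (rev_loc x) (rev_regex R)"
| "null x (NegLookahead R) \<longleftrightarrow> \<not> is_match x R"
| "null x (NegLookback R) \<longleftrightarrow> \<not> is_match (rev_loc x) (rev_regex R)"
| "der x (Pred p) = (if char_in (fst x) (snd x) (sat A p) then Epsilon else Pred (pfalse A))"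
| "der x Epsilon = Pred (pfalse A)"
| "der x (Alt R S) = Alt (der x R) (der x S)"
| "der x (And R S) = And (der x R) (der x S)"
| "der x (Concat R S) =
    (if null x R then Alt (Concat (der x R) S) (der x S) else Concat (der x R) S)"
| "der x (Loop R m n) =
    (if m = 0 \<or> (\<forall>y. valid y \<longrightarrow> null y R) \<or> \<not> null x R
     then Concat (der x R) (loop R (m - 1) (n - 1))
     else der x (Concat R (loop R (m - 1) (n - 1))))"
| "der x (Compl R) = Compl (der x R)"
| "der x (Lookahead R) = Pred (pfalse A)"
| "der x (Lookback R) = Pred (pfalse A)"
| "der x (NegLookahead R) = Pred (pfalse A)"
| "der x (NegLookback R) = Pred (pfalse A)"
| "match_end x R =
    (if valid x \<and> \<not> final x
     then max_loc (if null x R then x else fail) (match_end (next_loc x) (der x R))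
     else (if null x R then x else fail))"
| "is_match x R \<longleftrightarrow> match_end x R \<noteq> fail"
  by pat_completeness auto

lemma look_depth_der_aux:
  "null_der_match_end_is_match_dom (Inl (Inl (x1, R1))) \<Longrightarrow> True"
  "null_der_match_end_is_match_dom (Inl (Inr (x, R))) \<Longrightarrow> look_depth (der x R) \<le> look_depth R"
  "null_der_match_end_is_match_dom (Inr (Inl (x2, R2))) \<Longrightarrow> True"
  "null_der_match_end_is_match_dom (Inr (Inr (x3, R3))) \<Longrightarrow> True"
proof (induction x1 R1 and x R and x2 R2 and x3 R3 rule: null_der_match_end_is_match.pinduct)
  case (17 x R m n)
  have l: "look_depth (loop R (m - 1) (n - 1)) \<le> look_depth R"
    by (rule look_depth_loop_le)
  show ?case
  proof (cases "m = 0 \<or> (\<forall>y. valid y \<longrightarrow> null y R) \<or> \<not> null x R")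
    case True
    then have "look_depth (der x R) \<le> look_depth R"
      using 17 by blast
    with True l show ?thesis
      by (simp add: der.psimps(6)[OF 17(1)])
  next
    case False
    then have "look_depth (der x (Concat R (loop R (m - 1) (n - 1))))
        \<le> look_depth (Concat R (loop R (m - 1) (n - 1)))"
      using 17 by blast
    moreover have "der x (Loop R m n) = der x (Concat R (loop R (m - 1) (n - 1)))"
      unfolding der.psimps(6)[OF 17(1)] by (rule if_not_P) (rule False)
    ultimately show ?thesis
      using l by simp
  qed
qed (auto simp: der.psimps)

termination
proof (relation "measures
    [\<lambda>v. case v of Inl (Inl (x, R)) \<Rightarrow> look_depth R | Inl (Inr (x, R)) \<Rightarrow> look_depth R
        | Inr (Inl (x, R)) \<Rightarrow> look_depth R | Inr (Inr (x, R)) \<Rightarrow> look_depth R,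
     \<lambda>v. case v of Inl _ \<Rightarrow> 0
        | Inr (Inl (x, R)) \<Rightarrow> Suc (nat (int (length (fst x)) - snd x))
        | Inr (Inr (x, R)) \<Rightarrow> Suc (Suc (nat (int (length (fst x)) - snd x))),
     \<lambda>v. case v of Inl (Inl (x, R)) \<Rightarrow> unfold_size R | Inl (Inr (x, R)) \<Rightarrow> unfold_size R | Inr _ \<Rightarrow> 0]",
   goal_cases)
  case (29 x R)
  then show ?case
    using look_depth_der_aux(2)[of x R]
    by (auto simp: valid_def final_def next_loc_def le_less)
qed (simp_all add: max_def loop_def flip: le_less)

definition null_set :: "'c location \<Rightarrow> 'p regex \<Rightarrow> 'c location set" where
  "null_set x R = (if null x R then {x} else {})"

function match_ends :: "'c location \<Rightarrow> 'p regex \<Rightarrow> 'c location set" where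
  "match_ends x R =
    (if valid x \<and> \<not> final x
     then null_set x R \<union> match_ends (next_loc x) (der x R)
     else null_set x R)"
  by pat_completeness auto
termination
  by (relation "measure (\<lambda>(x, R). nat (int (length (fst x)) - snd x))")
    (auto simp: valid_def final_def next_loc_def)

definition derives :: "'c location \<Rightarrow> 'p regex \<Rightarrow> 'c location \<Rightarrow> bool" where
  "derives x R y \<longleftrightarrow> y \<in> match_ends x R"

definition regex_equiv :: "'p regex \<Rightarrow> 'p regex \<Rightarrow> bool" where
  "regex_equiv R S \<longleftrightarrow> (\<forall>x y. valid x \<longrightarrow> valid y \<longrightarrow> (derives x R y \<longleftrightarrow> derives x S y))"

end

declare match_end.simps [simp del] is_match.simps [simp del] match_ends.simps [simp del]


section \<open>Closure of the regexes under the operations\<close>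

lemma wf_regex_loop:
  "wf_regex R \<Longrightarrow> enat m \<le> n \<Longrightarrow> wf_regex (loop R m n)"
  by (auto simp: loop_def loop_bounds_def zero_enat_def)

lemma loop_eq_Loop: "loop_bounds m n \<Longrightarrow> loop R m n = Loop R m n"
  by (auto simp: loop_def loop_bounds_def)

lemma loop_bounds_diff: "loop_bounds m n \<Longrightarrow> enat (m - 1) \<le> n - 1"
  by (cases n) (auto simp: loop_bounds_def one_enat_def)

lemma wf_regex_rev: "wf_regex (rev_regex R) \<longleftrightarrow> wf_regex R"
  by (induction R) auto

lemma wf_regex_der: "wf_regex R \<Longrightarrow> wf_regex (der A x R)"
proof (induction R rule: measure_induct_rule[of unfold_size])
  case (less R)
  show ?case
  proof (cases R)
    case (Loop S m n)
    have S: "wf_regex S" and l: "wf_regex (loop S (m - 1) (n - 1))"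
      using less.prems Loop wf_regex_loop[OF _ loop_bounds_diff] by auto
    have "wf_regex (der A x S)"
      using less.IH[of S] S Loop by simp
    moreover have "wf_regex (der A x (Concat S (loop S (m - 1) (n - 1))))" if "m \<noteq> 0"
    proof (rule less.IH)
      show "unfold_size (Concat S (loop S (m - 1) (n - 1))) < unfold_size R"
        using that unfold_size_loop_less[of m S n] Loop by simp
    qed (use S l in simp)
    ultimately show ?thesis
      using l Loop by (auto split: if_splits)
  qed (use less in auto)
qed

end

(*
  Unfolding one derivative step, (1)-(7) follow by induction on the number of characters to the
  right of x. For loops, both (8) and (9) are read off from the description of the match ends of
  R{m,n} as the union of the relational powers of R with exponents between m and n. When m = 0 or R
  is always nullable, this description rests on dropping the empty iterations of R: the first
  remaining iteration consumes a character and hence passes through the derivative of R.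
  For m > 0 it follows from the inclusion of R{m,n} in R R{m-1,n-1}, and the converse inclusion
  holds by the definition of derivatives unless R is always nullable.
*)

theory Submission
  imports Defs
begin

section \<open>Match ends and single derivative steps\<close>

lemma valid_next_loc: "valid x \<Longrightarrow> \<not> final x \<Longrightarrow> valid (next_loc x)"
  by (auto simp: valid_def final_def next_loc_def)

lemma fst_next_loc [simp]: "fst (next_loc x) = fst x"
  and snd_next_loc [simp]: "snd (next_loc x) = snd x + 1"
  by (simp_all add: next_loc_def)

text \<open>One iteration of a loop may consume several characters, so the loop proofs need the
  hypothesis at all later locations of the string, not only at the next one.\<close>

lemma location_induct [consumes 1, case_names step]:
  assumes "valid x"
    and step: "\<And>x. valid x \<Longrightarrow> (\<And>z. valid z \<Longrightarrow> fst z = fst x \<Longrightarrow> snd x < snd z \<Longrightarrow> P z) \<Longrightarrow> P x"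
  shows "P x"
  using assms(1)
proof (induction "nat (int (length (fst x)) - snd x)" arbitrary: x rule: less_induct)
  case less
  show ?case
  proof (rule step[OF less.prems])
    fix z :: "'a location"
    assume "valid z" "fst z = fst x" "snd x < snd z"
    then show "P z"
      using less.hyps[of z] by (simp add: valid_def)
  qed
qed

lemma next_loc_induct [consumes 1, case_names step]:
  assumes "valid x"
    and step: "\<And>x. valid x \<Longrightarrow> (\<not> final x \<Longrightarrow> P (next_loc x)) \<Longrightarrow> P x"
  shows "P x"
  using assms(1)
proof (induction x rule: location_induct)
  case (step x)
  show ?case
    by (rule assms(2)) (simp_all add: valid_next_loc step)
qed

lemma derives_iff:
  assumes "valid x"
  shows "derives A x R y \<longleftrightarrow>
    null A x R \<and> x = y \<or> \<not> final x \<and> derives A (next_loc x) (der A x R) y"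
  using assms unfolding derives_def by (subst match_ends.simps) (auto simp: null_set_def)

text \<open>Each derivative step moves one position to the right within the same string and none is
  taken at its end. This makes lemmas and induction hypotheses applicable where a partial match
  ends.\<close>

lemma derives_location:
  assumes "valid x" "derives A x R y"
  shows "fst y = fst x \<and> snd x \<le> snd y \<and> valid y"
  using assms
proof (induction x arbitrary: R rule: next_loc_induct)
  case (step x)
  show ?case
  proof (cases "null A x R \<and> x = y")
    case False
    then have "\<not> final x" "derives A (next_loc x) (der A x R) y"
      using step.prems step.hyps by (auto simp: derives_iff)
    with step.IH step.hyps show ?thesis
      by (force simp: valid_next_loc)
  qed (use step.hyps in auto)
qed

lemma derives_same: "valid x \<Longrightarrow> derives A x R x \<longleftrightarrow> null A x R"
  using derives_location[of "next_loc x" A "der A x R" x]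
  by (auto simp: derives_iff[of x] valid_next_loc)

text \<open>Together with \<open>derives_same\<close> this separates empty from consuming matches.
  Unlike the disjunction in \<open>derives_iff\<close>, these two equivalences pass directly through
  intersection and negation.\<close>

lemma derives_proper:
  "valid x \<Longrightarrow> x \<noteq> y \<Longrightarrow>
    derives A x R y \<longleftrightarrow> \<not> final x \<and> derives A (next_loc x) (der A x R) y"
  by (auto simp: derives_iff[of x])

lemma derives_derI:
  "valid x \<Longrightarrow> \<not> final x \<Longrightarrow> derives A (next_loc x) (der A x R) y \<Longrightarrow> derives A x R y"
  by (simp add: derives_iff[of x])

lemma derives_after_next:
  assumes "valid x" "\<not> final x" "derives A (next_loc x) R y"
  shows "valid y" "fst y = fst x" "snd x < snd y"
  using derives_location[OF valid_next_loc[OF assms(1,2)] assms(3)] by auto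


section \<open>Regexes other than loops\<close>

text \<open>The false predicate is never nullable and is its own derivative, because no character
  satisfies it.\<close>

lemma not_derives_pfalse:
  assumes "effective_boolean_algebra A" "valid x"
  shows "\<not> derives A x (Pred (pfalse A)) y"
  using assms(2)
proof (induction x rule: next_loc_induct)
  case (step x)
  have "der A x (Pred (pfalse A)) = Pred (pfalse A)"
    using assms(1) by (simp add: char_in_def effective_boolean_algebra.sat_pfalse)
  with step show ?case
    by (auto simp: derives_iff[of x] simp del: der.simps)
qed

lemma derives_Epsilon:
  assumes "effective_boolean_algebra A" "valid x"
  shows "derives A x Epsilon y \<longleftrightarrow> x = y"
  using assms by (auto simp: derives_iff[of x] valid_next_loc not_derives_pfalse)

lemma derives_lookaround:
  assumes "effective_boolean_algebra A" "valid x" "is_lookaround l"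
  shows "derives A x l y \<longleftrightarrow> null A x l \<and> x = y"
proof -
  have "der A x l = Pred (pfalse A)"
    using assms(3) by (cases l) auto
  with assms show ?thesis
    by (auto simp: derives_iff[of x] valid_next_loc not_derives_pfalse)
qed

lemma derives_Pred:
  assumes "effective_boolean_algebra A" "valid (s, i)"
  shows "derives A (s, i) (Pred p) y \<longleftrightarrow> char_in s i (sat A p) \<and> y = (s, i + 1)"
proof -
  have "\<not> final (s, i)" if "char_in s i (sat A p)"
    using that by (simp add: char_in_def final_def)
  moreover have "next_loc (s, i) = (s, i + 1)"
    by (simp add: next_loc_def)
  ultimately show ?thesis
    using assms valid_next_loc[of "(s, i)"]
    by (auto simp: derives_iff[of "(s, i)"] not_derives_pfalse derives_Epsilon)
qed

lemma derives_Alt: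
  assumes "valid x"
  shows "derives A x (Alt R S) y \<longleftrightarrow> derives A x R y \<or> derives A x S y"
  using assms
proof (induction x arbitrary: R S rule: next_loc_induct)
  case (step x)
  then show ?case
    by (auto simp: derives_iff[of x] valid_next_loc)
qed

lemma derives_And:
  assumes "valid x"
  shows "derives A x (And R S) y \<longleftrightarrow> derives A x R y \<and> derives A x S y"
  using assms
proof (induction x arbitrary: R S rule: next_loc_induct)
  case (step x)
  then show ?case
    by (cases "x = y") (auto simp: derives_same derives_proper valid_next_loc)
qed

text \<open>If \<open>y\<close> lies in another string or to the left of \<open>x\<close>, neither
  \<open>R\<close> nor its complement has \<open>y\<close> as a match end; hence the restriction. If
  \<open>y\<close> is strictly to the right, \<open>x\<close> is not final and both sides take a
  derivative step.\<close>

lemma derives_Compl: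
  assumes "valid x" "valid y" "fst x = fst y" "snd x \<le> snd y"
  shows "derives A x (Compl R) y \<longleftrightarrow> \<not> derives A x R y"
  using assms
proof (induction x arbitrary: R rule: next_loc_induct)
  case (step x)
  show ?case
  proof (cases "x = y")
    case False
    then have "snd x < snd y"
      using step.prems by (auto simp: prod_eq_iff)
    then have "\<not> final x"
      using step.prems by (auto simp: valid_def final_def)
    with False \<open>snd x < snd y\<close> step show ?thesis
      by (simp add: derives_proper valid_next_loc)
  qed (use step.hyps in \<open>auto simp: derives_same\<close>)
qed

lemma derives_Concat:
  assumes "valid x"
  shows "derives A x (Concat R S) y \<longleftrightarrow> (\<exists>z. derives A x R z \<and> derives A z S y)"
  using assms
proof (induction x arbitrary: R rule: next_loc_induct)
  case (step x)
  show ?case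
  proof (cases "final x")
    case True
    with step.hyps show ?thesis
      by (auto simp del: split_paired_Ex simp: derives_iff[of x])
  next
    case False
    \<comment> \<open>Both factors match emptily, or \<open>R\<close> consumes the first character,
      or \<open>R\<close> matches emptily and \<open>S\<close> consumes it.\<close>
    have "derives A x (Concat R S) y \<longleftrightarrow> null A x R \<and> null A x S \<and> x = y \<or>
        derives A (next_loc x) (Concat (der A x R) S) y \<or>
        null A x R \<and> derives A (next_loc x) (der A x S) y"
      using step.hyps False by (auto simp: derives_iff[of x] derives_Alt valid_next_loc)
    moreover have "derives A x R z \<longleftrightarrow>
        null A x R \<and> x = z \<or> derives A (next_loc x) (der A x R) z" for z
      using step.hyps False by (auto simp: derives_iff[of x])
    moreover have "derives A x S y \<longleftrightarrow>
        null A x S \<and> x = y \<or> derives A (next_loc x) (der A x S) y"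
      using step.hyps False by (auto simp: derives_iff[of x])
    ultimately show ?thesis
      using step.IH[OF False] by metis
  qed
qed


section \<open>Loops as relational powers\<close>

abbreviation (input) iter
    :: "('p, 'c) eba \<Rightarrow> 'p regex \<Rightarrow> nat \<Rightarrow> 'c location \<Rightarrow> 'c location \<Rightarrow> bool" where
  "iter A R k \<equiv> (\<lambda>x y. derives A x R y) ^^ k"

text \<open>Splits off the first factor of a power, whereas \<open>relpowp.simps\<close> splits off
  the last.\<close>

lemma relpowp_Suc_iff2: "(P ^^ Suc k) x y \<longleftrightarrow> (\<exists>z. P x z \<and> (P ^^ k) z y)"
  by (meson relpowp_Suc_D2 relpowp_Suc_I2)

text \<open>Here the derivative passes to the first iteration. The bound \<open>n \<noteq> 0\<close>
  excludes the convention that \<open>loop R 0 0\<close> is \<open>Epsilon\<close>.\<close>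

lemma der_loop_0:
  assumes "n \<noteq> 0" "m = 0 \<or> (\<forall>y::'c location. valid y \<longrightarrow> null A y R)"
  shows "der A (x :: 'c location) (loop R m n) = Concat (der A x R) (loop R (m - 1) (n - 1))"
  using assms by (auto simp: loop_def[of R m n] simp del: split_paired_All)

lemma enat_Suc_le_iff: "enat (Suc k) \<le> n \<longleftrightarrow> n \<noteq> 0 \<and> enat k \<le> n - 1"
  by (cases n) (auto simp: zero_enat_def one_enat_def)

text \<open>Iterations that stay at \<open>x\<close> are dropped; this is harmless because the last
  assumption makes the lower bound \<open>m\<close> void.\<close>

lemma derives_loop_if_iter:
  fixes x :: "'c location"
  assumes "effective_boolean_algebra A" "valid x" "iter A R k x y" "enat k \<le> n"
    and "m = 0 \<or> (\<forall>y::'c location. valid y \<longrightarrow> null A y R)"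
  shows "derives A x (loop R m n) y"
  using assms(2-)
proof (induction x arbitrary: k m n rule: location_induct)
  case (step x)
  from \<open>iter A R k x y\<close> \<open>enat k \<le> n\<close> show ?case
  \<comment> \<open>The outer induction covers iterations that move to the right, this inner one
    covers empty iterations, where the location stays \<open>x\<close>.\<close>
  proof (induction k)
    case 0
    have "null A x (loop R m n)"
      using step.prems(3) step.hyps by (auto simp: loop_def simp del: split_paired_All)
    then show ?case
      using 0 step.hyps by (simp add: derives_same)
  next
    case (Suc k)
    then obtain z where z: "derives A x R z" "iter A R k z y"
      by (auto simp only: relpowp_Suc_iff2)
    have n: "n \<noteq> 0" "enat k \<le> n - 1" "enat k \<le> n"
      using Suc.prems(2) by (auto simp: enat_Suc_le_iff intro: order_trans[of _ "enat (Suc k)"])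
    show ?case
    proof (cases "z = x")
      case True
      with z n Suc.IH show ?thesis by simp
    next
      case False
      with z step.hyps have d: "\<not> final x" "derives A (next_loc x) (der A x R) z"
        by (simp_all add: derives_proper)
      \<comment> \<open>The alternative on \<open>m\<close> and \<open>R\<close> survives the step,
        since \<open>0 - 1 = 0\<close>.\<close>
      have "derives A z (loop R (m - 1) (n - 1)) y"
        using step.prems(3) derives_after_next[OF step.hyps d]
        by (intro step.IH[of z k "n - 1"] z n) auto
      with d step.hyps have "derives A (next_loc x) (der A x (loop R m n)) y"
        by (auto simp: der_loop_0[OF n(1) step.prems(3)] derives_Concat valid_next_loc
            simp del: split_paired_Ex)
      then show ?thesis
        by (rule derives_derI[OF step.hyps d(1)])
    qed
  qed
qed

text \<open>Each derivative step exposes a consuming first iteration and leaves a loop with lower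
  bound still 0 and upper bound \<open>n - 1\<close>; the exponent counts these iterations.\<close>

lemma iter_if_derives_loop_0:
  assumes "effective_boolean_algebra A" "valid x" "derives A x (loop R 0 n) y"
  shows "\<exists>k. enat k \<le> n \<and> iter A R k x y"
  using assms(2,3)
proof (induction x arbitrary: n rule: location_induct)
  case (step x)
  show ?case
  proof (cases "x = y")
    case True
    then show ?thesis
      by (intro exI[of _ 0]) (simp add: zero_enat_def[symmetric])
  next
    case False
    with step have d: "\<not> final x" "derives A (next_loc x) (der A x (loop R 0 n)) y"
      by (simp_all add: derives_proper)
    \<comment> \<open>Otherwise the loop is \<open>Epsilon\<close>, which would force
      \<open>x = y\<close>.\<close>
    have n: "n \<noteq> 0"
      using step False assms(1) by (auto simp: loop_def derives_Epsilon)
    with d obtain z where z: "derives A (next_loc x) (der A x R) z" "derives A z (loop R 0 (n - 1)) y"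
      using step.hyps by (auto simp: der_loop_0 derives_Concat valid_next_loc)
    obtain k where "enat k \<le> n - 1" "iter A R k z y"
      using step.IH[OF derives_after_next[OF step.hyps d(1) z(1)] z(2)] by blast
    moreover have "derives A x R z"
      using derives_derI[OF step.hyps d(1) z(1)] .
    ultimately show ?thesis
      using n by (intro exI[of _ "Suc k"])
        (auto simp: enat_Suc_le_iff simp del: relpowp.simps intro: relpowp_Suc_I2)
  qed
qed

text \<open>In either branch of its definition the derivative of the loop is the derivative of the
  concatenation or one alternative of it.\<close>

lemma derives_loop_unfoldD:
  assumes "effective_boolean_algebra A" "valid x" "m > 0" "derives A x (loop R m n) y"
  shows "derives A x (Concat R (loop R (m - 1) (n - 1))) y"
proof (cases "x = y")
  case True
  with assms show ?thesis
    by (auto simp: derives_same loop_def)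
next
  case False
  with assms have d: "\<not> final x" "derives A (next_loc x) (der A x (loop R m n)) y"
    by (simp_all add: derives_proper)
  then show ?thesis
    using assms(2,3) by (intro derives_derI[OF assms(2) d(1)])
      (auto simp: loop_def[of R m n] derives_Alt valid_next_loc split: if_splits)
qed

lemma derives_loop_unfoldI:
  fixes x :: "'c location"
  assumes "valid x" "m > 0" "derives A x (Concat R (loop R (m - 1) (n - 1))) y"
    and "\<not> (\<forall>y::'c location. valid y \<longrightarrow> null A y R)"
  shows "derives A x (loop R m n) y"
proof (cases "x = y")
  case True
  with assms show ?thesis
    by (auto simp: derives_same loop_def)
next
  case False
  \<comment> \<open>If \<open>R\<close> is not nullable at \<open>x\<close>, the concatenation rule
    has no second alternative; otherwise the loop takes its last branch.\<close>
  have "der A x (loop R m n) = der A x (Concat R (loop R (m - 1) (n - 1)))"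
    using assms(2,4) by (auto simp: loop_def[of R m n])
  with False assms show ?thesis
    by (simp add: derives_proper del: der.simps)
qed

lemma derives_loop_iff_iter:
  fixes x :: "'c location"
  assumes "effective_boolean_algebra A" "valid x" "enat m \<le> n"
  shows "derives A x (loop R m n) y \<longleftrightarrow> (\<exists>k\<ge>m. enat k \<le> n \<and> iter A R k x y)"
  using assms(2,3)
proof (induction m arbitrary: x n)
  case 0
  show ?case
  proof
    assume "derives A x (loop R 0 n) y"
    from iter_if_derives_loop_0[OF assms(1) 0(1) this]
    show "\<exists>k\<ge>0. enat k \<le> n \<and> iter A R k x y"
      by simp
  next
    assume "\<exists>k\<ge>0. enat k \<le> n \<and> iter A R k x y"
    then obtain k where k: "enat k \<le> n" "iter A R k x y"
      by (elim exE conjE)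
    show "derives A x (loop R 0 n) y"
      by (rule derives_loop_if_iter[OF assms(1) 0(1) k(2,1)]) simp
  qed
next
  case (Suc m)
  note x = \<open>valid x\<close>
  have n: "n \<noteq> 0" "enat m \<le> n - 1"
    using Suc.prems by (auto simp: enat_Suc_le_iff)
  have IH: "derives A z (loop R m (n - 1)) y \<longleftrightarrow>
      (\<exists>k\<ge>m. enat k \<le> n - 1 \<and> iter A R k z y)" if "derives A x R z" for z
    using Suc.IH[OF _ n(2)] derives_location[OF x that] by blast
  \<comment> \<open>The first iteration is split off, which lowers the exponent and both bounds by
    one.\<close>
  have *: "derives A x (Concat R (loop R m (n - 1))) y \<longleftrightarrow>
      (\<exists>k\<ge>Suc m. enat k \<le> n \<and> iter A R k x y)" (is "?L \<longleftrightarrow> ?R")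
  proof
    assume ?L
    then obtain z k where "derives A x R z" "k \<ge> m" "enat k \<le> n - 1" "iter A R k z y"
      using x IH by (auto simp: derives_Concat)
    then show ?R
      using n by (intro exI[of _ "Suc k"])
        (auto simp: enat_Suc_le_iff simp del: relpowp.simps intro: relpowp_Suc_I2)
  next
    assume ?R
    then obtain k where "k \<ge> m" "enat (Suc k) \<le> n" "iter A R (Suc k) x y"
      by (metis Suc_le_D Suc_le_mono)
    then obtain z where "derives A x R z" "iter A R k z y"
      by (auto simp only: relpowp_Suc_iff2)
    with \<open>k \<ge> m\<close> \<open>enat (Suc k) \<le> n\<close> show ?L
      unfolding derives_Concat[OF x] enat_Suc_le_iff using IH by blast
  qed
  show ?case
  proof (cases "\<forall>y::'c location. valid y \<longrightarrow> null A y R")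
    case True
    \<comment> \<open>With \<open>R\<close> nullable everywhere, the converse comes from dropping
      empty iterations instead of from folding the concatenation back into the loop.\<close>
    then show ?thesis
      using * derives_loop_unfoldD[OF assms(1) x, of "Suc m" R n y]
        derives_loop_if_iter[OF assms(1) x, of _ R y n "Suc m"]
      unfolding diff_Suc_1 by blast
  next
    case False
    then show ?thesis
      using * derives_loop_unfoldD[OF assms(1) x, of "Suc m" R n y]
        derives_loop_unfoldI[OF x, of "Suc m" A R n y]
      unfolding diff_Suc_1 by blast
  qed
qed

section \<open>Unfolding laws for loops\<close>

lemma ex_Suc_bounds:
  assumes "m > 0" "enat m \<le> n"
  shows "(\<exists>k\<ge>m. enat k \<le> n \<and> P k) \<longleftrightarrow> (\<exists>k\<ge>m - 1. enat k \<le> n - 1 \<and> P (Suc k))"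
proof
  assume "\<exists>k\<ge>m. enat k \<le> n \<and> P k"
  then obtain k where k: "k \<ge> m" "enat k \<le> n" "P k" by blast
  with \<open>m > 0\<close> obtain j where "k = Suc j" by (cases k) auto
  with k show "\<exists>k\<ge>m - 1. enat k \<le> n - 1 \<and> P (Suc k)"
    by (intro exI[of _ j]) (auto simp: enat_Suc_le_iff)
next
  assume "\<exists>k\<ge>m - 1. enat k \<le> n - 1 \<and> P (Suc k)"
  then obtain k where k: "k \<ge> m - 1" "enat k \<le> n - 1" "P (Suc k)" by blast
  have "n \<noteq> 0"
    using assms by (auto simp: zero_enat_def)
  with k show "\<exists>k\<ge>m. enat k \<le> n \<and> P k"
    by (intro exI[of _ "Suc k"]) (auto simp: enat_Suc_le_iff)
qed

text \<open>Derivatives only expose the first iteration. Powers of a relation can be split at either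
  end, which also yields the law with \<open>R\<close> on the right.\<close>

lemma derives_Concat_loop:
  assumes "effective_boolean_algebra A" "valid x" "m > 0" "enat m \<le> n"
  shows "derives A x (Concat R (loop R (m - 1) (n - 1))) y \<longleftrightarrow> derives A x (loop R m n) y"
    and "derives A x (Concat (loop R (m - 1) (n - 1)) R) y \<longleftrightarrow> derives A x (loop R m n) y"
proof -
  have mn: "enat (m - 1) \<le> n - 1"
    using assms(3,4) by (cases m) (auto simp: enat_Suc_le_iff)
  have loop: "derives A z (loop R (m - 1) (n - 1)) w \<longleftrightarrow>
      (\<exists>k\<ge>m - 1. enat k \<le> n - 1 \<and> iter A R k z w)" if "valid z" for z w
    using derives_loop_iff_iter[OF assms(1) that mn] .
  have target: "derives A x (loop R m n) y \<longleftrightarrow>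
      (\<exists>k\<ge>m - 1. enat k \<le> n - 1 \<and> iter A R (Suc k) x y)"
    unfolding derives_loop_iff_iter[OF assms(1,2,4)] by (rule ex_Suc_bounds[OF assms(3,4)])
  have "derives A x (Concat R (loop R (m - 1) (n - 1))) y \<longleftrightarrow>
      (\<exists>z. derives A x R z \<and> (\<exists>k\<ge>m - 1. enat k \<le> n - 1 \<and> iter A R k z y))"
    using loop derives_location[OF assms(2)] unfolding derives_Concat[OF assms(2)] by blast
  then show "derives A x (Concat R (loop R (m - 1) (n - 1))) y \<longleftrightarrow> derives A x (loop R m n) y"
    unfolding target relpowp_Suc_iff2 by blast
  have "derives A x (Concat (loop R (m - 1) (n - 1)) R) y \<longleftrightarrow>
      (\<exists>z. (\<exists>k\<ge>m - 1. enat k \<le> n - 1 \<and> iter A R k x z) \<and> derives A z R y)"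
    using loop[OF assms(2)] by (auto simp: derives_Concat[OF assms(2)])
  then show "derives A x (Concat (loop R (m - 1) (n - 1)) R) y \<longleftrightarrow> derives A x (loop R m n) y"
    unfolding target relpowp.simps relcompp_apply by blast
qed

text \<open>The exponent 0 is separated from the others; the zeroth power is equality, the match
  relation of \<open>Epsilon\<close>.\<close>

lemma derives_loop_0:
  assumes "effective_boolean_algebra A" "valid x" "n \<ge> 1"
  shows "derives A x (loop R 0 n) y \<longleftrightarrow> derives A x (Alt (loop R 1 n) Epsilon) y"
proof -
  have *: "enat 0 \<le> n" "enat 1 \<le> n"
    using assms(3) by (simp_all add: one_enat_def zero_enat_def[symmetric])
  have "(\<exists>k\<ge>0. enat k \<le> n \<and> iter A R k x y) \<longleftrightarrow>
      (\<exists>k\<ge>1. enat k \<le> n \<and> iter A R k x y) \<or> x = y"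
    using *(1) by (metis One_nat_def Suc_leI gr0I le0 relpowp_0_E relpowp_0_I)
  then show ?thesis
    using assms * by (simp only: derives_loop_iff_iter derives_Alt derives_Epsilon)
qed

theorem theorem1:
  fixes A :: "('p, 'c) eba"
    and R S l :: "'p regex"
    and psi :: 'p
  assumes eba: "effective_boolean_algebra A"
    and R: "wf_regex R"
    and S: "wf_regex S"
    and l: "wf_regex l" "is_lookaround l"
  shows
    "(\<forall>x y. valid x \<longrightarrow> valid y \<longrightarrow>
        (derives A x Epsilon y \<longleftrightarrow> x = y)) \<and>
     (\<forall>x y. valid x \<longrightarrow> valid y \<longrightarrow>
        (derives A x l y \<longleftrightarrow> null A x l \<and> x = y)) \<and>
     (\<forall>s i y. valid (s, i) \<longrightarrow> valid y \<longrightarrow>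
        (derives A (s, i) (Pred psi) y \<longleftrightarrow> char_in s i (sat A psi) \<and> y = (s, i + 1))) \<and>
     (\<forall>x y. valid x \<longrightarrow> valid y \<longrightarrow>
        (derives A x (Alt R S) y \<longleftrightarrow> derives A x R y \<or> derives A x S y)) \<and>
     (\<forall>x y. valid x \<longrightarrow> valid y \<longrightarrow>
        (derives A x (And R S) y \<longleftrightarrow> derives A x R y \<and> derives A x S y)) \<and>
     (\<forall>x y. valid x \<longrightarrow> valid y \<longrightarrow> fst x = fst y \<longrightarrow> snd x \<le> snd y \<longrightarrow>
        (derives A x (Compl R) y \<longleftrightarrow> \<not> derives A x R y)) \<and>
     (\<forall>x y. valid x \<longrightarrow> valid y \<longrightarrow>
        (derives A x (Concat R S) y \<longleftrightarrow> (\<exists>z. valid z \<and> derives A x R z \<and> derives A z S y))) \<and>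
     (\<forall>m n. loop_bounds m n \<longrightarrow> m > 0 \<longrightarrow>
        regex_equiv A (loop R m n) (Concat R (loop R (m - 1) (n - 1))) \<and>
        regex_equiv A (Concat R (loop R (m - 1) (n - 1))) (Concat (loop R (m - 1) (n - 1)) R)) \<and>
     (\<forall>n. n \<ge> 1 \<longrightarrow>
        regex_equiv A (loop R 0 n) (Alt (loop R 1 n) Epsilon))"
proof (intro conjI allI impI)
  fix x y :: "'c location"
  assume x: "valid x" and y: "valid y"
  show "derives A x Epsilon y \<longleftrightarrow> x = y"
    using derives_Epsilon[OF eba x] .
  show "derives A x l y \<longleftrightarrow> null A x l \<and> x = y"
    using derives_lookaround[OF eba x l(2)] .
  show "derives A x (Alt R S) y \<longleftrightarrow> derives A x R y \<or> derives A x S y"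
    using derives_Alt[OF x] .
  show "derives A x (And R S) y \<longleftrightarrow> derives A x R y \<and> derives A x S y"
    using derives_And[OF x] .
  show "derives A x (Compl R) y \<longleftrightarrow> \<not> derives A x R y" if "fst x = fst y" "snd x \<le> snd y"
    using derives_Compl[OF x y that] .
  \<comment> \<open>Every match end from a valid location is valid, so restricting \<open>z\<close>
    loses nothing.\<close>
  show "derives A x (Concat R S) y \<longleftrightarrow> (\<exists>z. valid z \<and> derives A x R z \<and> derives A z S y)"
    using derives_Concat[OF x] derives_location[OF x] by blast
next
  fix s :: "'c list" and i and y :: "'c location"
  assume "valid (s, i)"
  then show "derives A (s, i) (Pred psi) y \<longleftrightarrow> char_in s i (sat A psi) \<and> y = (s, i + 1)"
    by (rule derives_Pred[OF eba])
next
  fix m n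
  assume "loop_bounds m n" and m: "0 < m"
  then have mn: "enat m \<le> n"
    by (simp add: loop_bounds_def)
  show "regex_equiv A (loop R m n) (Concat R (loop R (m - 1) (n - 1)))"
    using derives_Concat_loop[OF eba _ m mn] by (simp add: regex_equiv_def)
  \<comment> \<open>Both concatenations are compared with \<open>loop R m n\<close>.\<close>
  show "regex_equiv A (Concat R (loop R (m - 1) (n - 1))) (Concat (loop R (m - 1) (n - 1)) R)"
    using derives_Concat_loop[OF eba _ m mn] by (simp add: regex_equiv_def)
next
  fix n :: enat
  assume "1 \<le> n"
  then show "regex_equiv A (loop R 0 n) (Alt (loop R 1 n) Epsilon)"
    using derives_loop_0[OF eba] unfolding regex_equiv_def by blast
qed

end
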